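(* For every integer $n\ge 0$, there exists an integer matrix $S_n\in\mathbb{Z}^{2^n\times 2^n}$ such that $\det S_n=\pm1$ and $V_nS_n=A_n$.
   Context: Define integers $\sigma(n,k)$, $n\ge 0$, $1\le k\le 2^n$, recursively by $\sigma(0,1)=1$ and, with $d=2^n$, $\sigma(n+1,k)=\sigma(n,k)$ if $1\le k\le d$, $\sigma(n+1,k)=2d+1-\sigma(n,k-d)$ if $d+1\le k\le 2d$. For $d=2^n$ define $\xi_{n,k}=2\cos\left(\frac{\pi(2\sigma(n,k)-1)}{2d}\right)$ for $1\le k\le d$. Let $V_n=(\xi_{n,i}^{\,j-1})_{i,j=1}^{d}\in\mathbb{R}^{d\times d}$ be the associated Vandermonde matrix (row $i$ is $1,\xi_{n,i},\dots,\xi_{n,i}^{d-1}$). Let $D_n=\operatorname{diag}(\xi_{n+1,1},\dots,\xi_{n+1,d})\in\mathbb{R}^{d\times d}$. Define matrices $A_n\in\mathbb{R}^{2^n\times 2^n}$ recursively by $A_0=1$ and $$A_{n+1}=\begin{pmatrix}A_n & D_nA_n\\ A_n & -D_nA_n\end{pmatrix}.$$ *)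

theory Defs
  imports Complex_Main "Jordan_Normal_Form.Determinant"
begin

text \<open>
  The index k is one-based: only the values for 1 \<le> k \<le> 2 ^ n are meaningful. Matrix entries are
  zero-based, so row i of a matrix below belongs to the one-based index i + 1.
\<close>

fun sigma :: "nat \<Rightarrow> nat \<Rightarrow> int" where
  "sigma 0 k = 1"
| "sigma (Suc n) k =
     (if k \<le> 2 ^ n then sigma n k else 2 * 2 ^ n + 1 - sigma n (k - 2 ^ n))"

definition xi :: "nat \<Rightarrow> nat \<Rightarrow> real" where
  "xi n k = 2 * cos (pi * (2 * real_of_int (sigma n k) - 1) / (2 * 2 ^ n))"

definition V_mat :: "nat \<Rightarrow> real mat" where
  "V_mat n = mat (2 ^ n) (2 ^ n) (\<lambda>(i, j). xi n (i + 1) ^ j)"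

text \<open>
  The matrix of level n has size 2 ^ n but takes its diagonal from level n + 1.
\<close>

definition D_mat :: "nat \<Rightarrow> real mat" where
  "D_mat n = mat_diag (2 ^ n) (\<lambda>i. xi (n + 1) (i + 1))"

fun A_mat :: "nat \<Rightarrow> real mat" where
  "A_mat 0 = 1\<^sub>m 1"
| "A_mat (Suc n) =
     four_block_mat (A_mat n) (D_mat n * A_mat n)
                    (A_mat n) (- (D_mat n * A_mat n))"

end

theory Submission imports Defs begin

text \<open>
  The columns of \<^term>\<open>A_mat n\<close> are the values, at the nodes \<^term>\<open>xi n\<close>, of monic integer
  polynomials \<open>p\<^sub>0, \<dots>, p\<^bsub>d-1\<^esub>\<close>, where \<open>d = 2 ^ n\<close>, and \<open>S\<close> collects their coefficients. The nodes
  of level \<open>n + 1\<close> are the pairs \<open>x, -x\<close> with \<open>x\<^sup>2 - 2\<close> a node of level \<open>n\<close>: this is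
  \<open>2 cos (2 \<theta>) = (2 cos \<theta>)\<^sup>2 - 2\<close>. The block recursion for \<^term>\<open>A_mat\<close> thus replaces each polynomial
  \<open>p\<close> by \<open>p (x\<^sup>2 - 2)\<close> in the left blocks and by \<open>x * p (x\<^sup>2 - 2)\<close> in the right blocks, and the
  coefficients of these are again integers.

  For the determinant, this substitution is split into two unimodular changes of basis. Taking the
  even powers before the odd powers permutes the columns of the Vandermonde matrix and turns it into
  blocks built from the Vandermonde matrix of the squared nodes (\<open>vandermonde_even_odd\<close>). Passing
  from powers of \<open>x\<^sup>2\<close> to powers of \<open>x\<^sup>2 - 2\<close> is multiplication by a unitriangular matrix of binomial
  coefficients (\<open>vandermonde_shift\<close>). Together with the induction hypothesis in each diagonal block
  they give \<open>S\<close> at level \<open>n + 1\<close> as a product of unimodular integer matrices.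
\<close>

section \<open>Changes of basis for Vandermonde matrices\<close>

definition vandermonde :: "nat \<Rightarrow> (nat \<Rightarrow> 'a::comm_ring_1) \<Rightarrow> 'a mat" where
  "vandermonde d x = mat d d (\<lambda>(i, j). x i ^ j)"

definition column_selection :: "nat \<Rightarrow> (nat \<Rightarrow> nat) \<Rightarrow> 'a::comm_ring_1 mat" where
  "column_selection d f = mat d d (\<lambda>(i, j). if i = f j then 1 else 0)"

definition even_odd_index :: "nat \<Rightarrow> nat \<Rightarrow> nat" where
  "even_odd_index d k = (if k < d then 2 * k else 2 * (k - d) + 1)"

text \<open>
  In the basis of powers of \<open>X\<close>, column \<open>j\<close> holds the coefficients of \<open>(X - c) ^ j\<close>.
\<close>

definition shift_mat :: "nat \<Rightarrow> 'a \<Rightarrow> 'a::comm_ring_1 mat" where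
  "shift_mat d c = mat d d (\<lambda>(k, j). of_nat (j choose k) * (- c) ^ (j - k))"

lemma vandermonde_carrier [simp]: "vandermonde d x \<in> carrier_mat d d"
  by (simp add: vandermonde_def)

lemma column_selection_carrier [simp]: "column_selection d f \<in> carrier_mat d d"
  by (simp add: column_selection_def)

lemma shift_mat_carrier [simp]: "shift_mat d c \<in> carrier_mat d d"
  by (simp add: shift_mat_def)

lemma map_column_selection:
  "map_mat of_int (column_selection d f) = column_selection d f"
  by (rule eq_matI) (auto simp: column_selection_def)

lemma map_shift_mat: "map_mat of_int (shift_mat d c) = shift_mat d (of_int c)"
  by (rule eq_matI) (auto simp: shift_mat_def)

lemma mult_column_selection:
  assumes A: "A \<in> carrier_mat m d" and f: "\<And>j. j < d \<Longrightarrow> f j < d"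
  shows "A * column_selection d f = mat m d (\<lambda>(i, j). A $$ (i, f j))"
proof (rule eq_matI)
  fix i j assume "i < dim_row (mat m d (\<lambda>(i, j). A $$ (i, f j)))"
    "j < dim_col (mat m d (\<lambda>(i, j). A $$ (i, f j)))"
  then have ij: "i < m" "j < d" by auto
  have "(A * column_selection d f) $$ (i, j)
      = (\<Sum>k = 0..<d. A $$ (i, k) * (if k = f j then 1 else 0))"
    using A ij by (simp add: scalar_prod_def column_selection_def)
  also have "\<dots> = A $$ (i, f j)"
    using f[OF ij(2)] by (simp add: if_distrib cong: if_cong)
  finally show "(A * column_selection d f) $$ (i, j) = mat m d (\<lambda>(i, j). A $$ (i, f j)) $$ (i, j)"
    using ij by simp
qed (use A in \<open>auto simp: column_selection_def\<close>)

text \<open>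
  The determinant of a permutation matrix is a sign because the transpose is the inverse.
\<close>

lemma abs_det_column_selection:
  assumes f: "\<And>j. j < d \<Longrightarrow> f j < d" and inj: "inj_on f {..<d}"
  shows "\<bar>det (column_selection d f :: int mat)\<bar> = 1"
proof -
  let ?P = "column_selection d f :: int mat"
  have "transpose_mat ?P * ?P = mat d d (\<lambda>(i, j). transpose_mat ?P $$ (i, f j))"
    by (rule mult_column_selection) (use f in auto)
  also have "\<dots> = 1\<^sub>m d"
    by (rule eq_matI) (use f inj in \<open>auto simp: column_selection_def inj_on_def\<close>)
  finally have "det (transpose_mat ?P * ?P) = 1" by simp
  then have "det ?P * det ?P = 1"
    by (simp add: det_mult[of _ d] det_transpose[of _ d])
  then show ?thesis
    by (metis abs_mult_self_eq abs_zmult_eq_1 abs_1)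
qed

lemma abs_det_even_odd:
  "\<bar>det (column_selection (d + d) (even_odd_index d) :: int mat)\<bar> = 1"
proof (rule abs_det_column_selection)
  show "inj_on (even_odd_index d) {..<d + d}"
    unfolding inj_on_def even_odd_index_def
    by (auto split: if_splits) presburger+
qed (auto simp: even_odd_index_def)

lemma det_shift_mat: "det (shift_mat d c) = 1"
proof -
  have "det (shift_mat d c) = prod_list (diag_mat (shift_mat d c))"
    by (rule det_upper_triangular[of _ d])
      (auto simp: shift_mat_def upper_triangular_def binomial_eq_0)
  also have "\<dots> = 1"
    by (simp add: prod_list_diag_prod shift_mat_def)
  finally show ?thesis .
qed

text \<open>
  By the binomial theorem; the coefficients \<open>j choose k\<close> with \<open>k > j\<close> vanish, so that the sum over
  all rows of the shift matrix is the binomial sum.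
\<close>

lemma vandermonde_shift:
  "vandermonde d y * shift_mat d c = vandermonde d (\<lambda>i. y i - c)"
proof (rule eq_matI)
  fix i j assume "i < dim_row (vandermonde d (\<lambda>i. y i - c))"
    "j < dim_col (vandermonde d (\<lambda>i. y i - c))"
  then have ij: "i < d" "j < d" by (auto simp: vandermonde_def)
  have "(vandermonde d y * shift_mat d c) $$ (i, j)
      = (\<Sum>k = 0..<d. y i ^ k * (of_nat (j choose k) * (- c) ^ (j - k)))"
    using ij by (simp add: scalar_prod_def vandermonde_def shift_mat_def)
  also have "\<dots> = (\<Sum>k\<le>j. of_nat (j choose k) * y i ^ k * (- c) ^ (j - k))"
    by (rule sum.mono_neutral_cong_right)
      (use ij in \<open>auto simp: algebra_simps binomial_eq_0 not_le\<close>)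
  also have "\<dots> = (y i - c) ^ j"
    using binomial_ring[of "y i" "- c" j] by simp
  finally show "(vandermonde d y * shift_mat d c) $$ (i, j)
      = vandermonde d (\<lambda>i. y i - c) $$ (i, j)"
    using ij by (simp add: vandermonde_def)
qed (auto simp: vandermonde_def shift_mat_def)

text \<open>
  Nodes in pairs \<open>x i, - x i\<close> agree in their even powers \<open>(x i ^ 2) ^ j\<close> and differ by a sign in
  their odd powers \<open>x i * (x i ^ 2) ^ j\<close>; the selection lists the former columns before the latter.
\<close>

lemma vandermonde_even_odd:
  fixes x :: "nat \<Rightarrow> 'a::comm_ring_1"
  assumes neg: "\<And>i. i < d \<Longrightarrow> x (d + i) = - x i"
  defines "W \<equiv> vandermonde d (\<lambda>i. x i ^ 2)"
  shows "vandermonde (d + d) x * column_selection (d + d) (even_odd_index d)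
    = four_block_mat W (mat_diag d x * W) W (- (mat_diag d x * W))"
    (is "_ = ?F")
proof -
  have W: "W \<in> carrier_mat d d" by (simp add: W_def)
  have dims: "dim_row W = d" "dim_col W = d" using W by auto
  have W_entry: "W $$ (i, j) = (x i ^ 2) ^ j" if "i < d" "j < d" for i j
    using that by (simp add: W_def vandermonde_def)
  have DW: "mat_diag d x * W \<in> carrier_mat d d"
    using W by (simp add: mult_carrier_mat[of _ d d])
  have DW_entry: "(mat_diag d x * W) $$ (i, j) = x i * (x i ^ 2) ^ j" if "i < d" "j < d" for i j
    using that by (simp add: mat_diag_mult_left[OF W] W_entry)
  have "vandermonde (d + d) x * column_selection (d + d) (even_odd_index d)
      = mat (d + d) (d + d) (\<lambda>(i, j). vandermonde (d + d) x $$ (i, even_odd_index d j))"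
    by (rule mult_column_selection) (auto simp: even_odd_index_def)
  also have "\<dots> = mat (d + d) (d + d) (\<lambda>(i, j). x i ^ even_odd_index d j)"
    by (rule eq_matI) (auto simp: vandermonde_def even_odd_index_def)
  also have "\<dots> = ?F"
  proof (rule eq_matI)
    fix i j assume "i < dim_row ?F" "j < dim_col ?F"
    then have ij: "i < d + d" "j < d + d" by (auto simp: dims mat_diag_def)
    have lower: "x i = - x (i - d)" if "\<not> i < d"
      using neg[of "i - d"] that ij by simp
    show "mat (d + d) (d + d) (\<lambda>(i, j). x i ^ even_odd_index d j) $$ (i, j) = ?F $$ (i, j)"
      using ij lower
      by (cases "i < d"; cases "j < d")
        (simp_all add: dims W_entry DW_entry index_uminus_mat carrier_matD[OF DW]
          even_odd_index_def power_mult del: index_mult_mat)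
  qed (auto simp: dims mat_diag_def)
  finally show ?thesis .
qed

section \<open>The nodes\<close>

lemma xi_square:
  assumes "k \<le> 2 ^ n"
  shows "xi (Suc n) k ^ 2 - 2 = xi n k"
proof -
  define t where "t = pi * (2 * real_of_int (sigma n k) - 1) / (2 * 2 ^ Suc n)"
  have "xi (Suc n) k = 2 * cos t" using assms by (simp add: xi_def t_def)
  moreover have "xi n k = 2 * cos (2 * t)" by (simp add: xi_def t_def)
  ultimately show ?thesis
    by (simp add: cos_double_cos power_mult_distrib)
qed

lemma xi_reflect:
  assumes "1 \<le> k" "k \<le> 2 ^ n"
  shows "xi (Suc n) (2 ^ n + k) = - xi (Suc n) k"
proof -
  define t where "t = pi * (2 * real_of_int (sigma n k) - 1) / (2 * 2 ^ Suc n)"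
  have "pi * (2 * real_of_int (sigma (Suc n) (2 ^ n + k)) - 1) / (2 * 2 ^ Suc n) = pi - t"
    using assms by (simp add: t_def field_simps)
  then have "xi (Suc n) (2 ^ n + k) = 2 * cos (pi - t)" by (simp add: xi_def)
  moreover have "xi (Suc n) k = 2 * cos t" using assms by (simp add: xi_def t_def)
  ultimately show ?thesis by simp
qed

lemma V_mat_eq_vandermonde: "V_mat n = vandermonde (2 ^ n) (\<lambda>i. xi n (i + 1))"
  by (simp add: V_mat_def vandermonde_def)

section \<open>The recursion step\<close>

lemma block_diag_right_mult:
  fixes W :: "'a::comm_ring_1 mat"
  assumes "W \<in> carrier_mat d d" "D \<in> carrier_mat d d" "T \<in> carrier_mat d d"
  shows "four_block_mat W (D * W) W (- (D * W)) * four_block_mat T (0\<^sub>m d d) (0\<^sub>m d d) T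
    = four_block_mat (W * T) (D * (W * T)) (W * T) (- (D * (W * T)))"
proof -
  have "D * W \<in> carrier_mat d d" "- (D * W) \<in> carrier_mat d d" using assms by auto
  with assms show ?thesis
    by (subst mult_four_block_mat[of _ d d _ d _ d _ _ d _ d]) auto
qed

theorem lemma3p1:
  fixes n :: nat
  shows "\<exists>S :: int mat. S \<in> carrier_mat (2 ^ n) (2 ^ n)
           \<and> (det S = 1 \<or> det S = - 1)
           \<and> V_mat n * map_mat real_of_int S = A_mat n"
proof (induction n)
  case 0
  have "V_mat 0 * map_mat real_of_int (1\<^sub>m 1) = A_mat 0"
    by (rule eq_matI) (auto simp: V_mat_def scalar_prod_def)
  then show ?case
    by (intro exI[of _ "1\<^sub>m 1"]) auto
next
  case (Suc n)
  then obtain S :: "int mat" where S: "S \<in> carrier_mat (2 ^ n) (2 ^ n)"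
    and det_S: "\<bar>det S\<bar> = 1" and VS: "V_mat n * map_mat real_of_int S = A_mat n"
    by fastforce
  define d :: nat where "d = 2 ^ n"
  define x where "x i = xi (Suc n) (i + 1)" for i
  define W where "W = vandermonde d (\<lambda>i. x i ^ 2)"
  \<comment> \<open>If column \<open>j\<close> of \<open>S\<close> is the polynomial \<open>p\<close>, column \<open>j\<close> of \<open>T\<close> is \<open>p (Y - 2)\<close>. The two blocks of \<open>U\<close>
    are the even and the odd part in \<open>X\<close>, with \<open>Y = X\<^sup>2\<close>, and \<open>P\<close> interleaves their coefficients, so
    that the witness at level \<open>n + 1\<close> is \<open>P * U\<close>.\<close>
  define P :: "int mat" where "P = column_selection (d + d) (even_odd_index d)"
  define T where "T = shift_mat d 2 * S"
  define U where "U = four_block_mat T (0\<^sub>m d d) (0\<^sub>m d d) T"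
  have S: "S \<in> carrier_mat d d" using S by (simp add: d_def)
  have T: "T \<in> carrier_mat d d" using S by (simp add: T_def mult_carrier_mat[of _ d d])
  have P: "P \<in> carrier_mat (d + d) (d + d)" by (simp add: P_def)
  have U: "U \<in> carrier_mat (d + d) (d + d)" using T by (simp add: U_def)
  have W: "W \<in> carrier_mat d d" by (simp add: W_def)
  have D: "D_mat n = mat_diag d x" "D_mat n \<in> carrier_mat d d"
    by (simp_all add: D_mat_def d_def x_def[abs_def])
  have V: "V_mat n = vandermonde d (\<lambda>i. x i ^ 2 - 2)"
    unfolding V_mat_eq_vandermonde
    by (auto simp: vandermonde_def d_def x_def xi_square intro!: cong_mat)

  have "det T = det S"
    using S by (simp add: T_def det_mult[of _ d] det_shift_mat)
  moreover have "det U = det T * det T"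
    unfolding U_def using T by (simp add: det_four_block_mat_upper_right_zero[of _ d _ d])
  ultimately have "\<bar>det (P * U)\<bar> = 1"
    using det_S abs_det_even_odd[of d, folded P_def]
    by (simp add: det_mult[OF P U] abs_mult)

  moreover have "V_mat (Suc n) * map_mat real_of_int (P * U) = A_mat (Suc n)"
  proof -
    have WT: "W * map_mat real_of_int T = A_mat n"
    proof -
      have "W * map_mat real_of_int T = W * (shift_mat d 2 * map_mat real_of_int S)"
        using S by (simp add: T_def of_int_hom.mat_hom_mult[of _ d d] map_shift_mat)
      also have "\<dots> = W * shift_mat d 2 * map_mat real_of_int S"
        using S W by (simp add: assoc_mult_mat[of _ d d _ d _ d])
      also have "\<dots> = A_mat n"
        using VS by (simp add: W_def vandermonde_shift V)
      finally show ?thesis .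
    qed
    have VP: "V_mat (Suc n) * map_mat real_of_int P
        = four_block_mat W (mat_diag d x * W) W (- (mat_diag d x * W))"
    proof -
      have "x (d + i) = - x i" if "i < d" for i
        using xi_reflect[of "i + 1" n] that by (simp add: x_def d_def add.assoc)
      then have "vandermonde (d + d) x * column_selection (d + d) (even_odd_index d)
          = four_block_mat W (mat_diag d x * W) W (- (mat_diag d x * W))"
        unfolding W_def by (rule vandermonde_even_odd)
      moreover have "V_mat (Suc n) = vandermonde (d + d) x"
        by (simp add: V_mat_eq_vandermonde d_def x_def[abs_def] mult_2)
      ultimately show ?thesis by (simp add: P_def map_column_selection)
    qed
    have map_U: "map_mat real_of_int U = four_block_mat (map_mat real_of_int T) (0\<^sub>m d d)
        (0\<^sub>m d d) (map_mat real_of_int T)"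
      unfolding U_def using T by (subst map_four_block_mat[of _ d d _ d _ d]) auto
    have "V_mat (Suc n) \<in> carrier_mat (d + d) (d + d)"
      by (simp add: V_mat_def d_def mult_2)
    then have "V_mat (Suc n) * map_mat real_of_int (P * U)
        = V_mat (Suc n) * map_mat real_of_int P * map_mat real_of_int U"
      using P U by (simp add: of_int_hom.mat_hom_mult[of _ "d + d" "d + d"]
          assoc_mult_mat[of _ "d + d" "d + d" _ "d + d" _ "d + d"])
    also have "\<dots> = A_mat (Suc n)"
      using block_diag_right_mult[OF W D(2), of "map_mat real_of_int T"] T
      by (simp add: VP map_U WT D(1))
    finally show ?thesis .
  qed
  moreover have "P * U \<in> carrier_mat (2 ^ Suc n) (2 ^ Suc n)"
    using P U by (simp add: d_def mult_2)
  ultimately show ?case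
    by (intro exI[of _ "P * U"]) auto
qed

end
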